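(* Let $\boldsymbol{\alpha}=\boldsymbol{\alpha}(\boldsymbol{\theta})\in\mathbb{R}^3\setminus\{0\}$ be a differentiable function of real parameters $\boldsymbol{\theta}=(\theta_1,\dots,\theta_n)$, let $t\in\mathbb{R}$ be independent of $\boldsymbol{\theta}$, and consider the unitary process $U(\boldsymbol{\theta})=e^{-iHt}$ generated by the Hamiltonian $H=\boldsymbol{\alpha}\cdot\boldsymbol{\sigma}$. Let $\hat{\boldsymbol{\alpha}}=\boldsymbol{\alpha}/|\boldsymbol{\alpha}|$. Then for each $i$ the vector $\boldsymbol{m}_{\theta_i}\in\mathbb{R}^3$ associated with the parameter $\theta_i$ is given by $$\boldsymbol{m}_{\theta_i}=\frac{\partial|\boldsymbol{\alpha}|}{\partial\theta_i}\,t\,\hat{\boldsymbol{\alpha}}+\sin(|\boldsymbol{\alpha}|t)\cos(|\boldsymbol{\alpha}|t)\,\frac{\partial\hat{\boldsymbol{\alpha}}}{\partial\theta_i}-\sin^2(|\boldsymbol{\alpha}|t)\left(\hat{\boldsymbol{\alpha}}\times\frac{\partial\hat{\boldsymbol{\alpha}}}{\partial\theta_i}\right).$$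
   Context: $\boldsymbol{\sigma}=(\sigma_1,\sigma_2,\sigma_3)$ are the Pauli matrices and $\boldsymbol{\alpha}\cdot\boldsymbol{\sigma}=\sum_k\alpha_k\sigma_k$. For a differentiable family $U(\boldsymbol{\theta})\in SU(2)$, the vector $\boldsymbol{m}_{\theta_i}\in\mathbb{R}^3$ associated with $\theta_i$ is defined by $[\boldsymbol{m}_{\theta_i}]_k=\tfrac12\mathrm{Tr}\{\sigma_kM_{\theta_i}\}$ for $k=1,2,3$, where $M_{\theta_i}=iU^\dagger(\boldsymbol{\theta})\frac{\partial U(\boldsymbol{\theta})}{\partial\theta_i}$. Here $\times$ is the cross product in $\mathbb{R}^3$. *)

theory Defs
  imports "HOL-Analysis.Analysis"
begin

definition smult_mat :: "complex \<Rightarrow> complex^'n^'m \<Rightarrow> complex^'n^'m" where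
  "smult_mat c A = (\<chi> i j. c * A $ i $ j)"

definition conj_transpose :: "complex^'n^'m \<Rightarrow> complex^'m^'n" where
  "conj_transpose A = (\<chi> i j. cnj (A $ j $ i))"

(* The library's times, power and exp on vectors are componentwise or not available,
   so powers are taken with respect to the matrix product. *)
definition mat_pow :: "complex^'n^'n \<Rightarrow> nat \<Rightarrow> complex^'n^'n" where
  "mat_pow A k = (((**) A) ^^ k) (mat 1)"

definition mat_exp :: "complex^'n^'n \<Rightarrow> complex^'n^'n" where
  "mat_exp A = (\<Sum>k. (1 / fact k) *\<^sub>R mat_pow A k)"

definition pauli :: "3 \<Rightarrow> complex^2^2" where
  "pauli k =
    (if k = 1 then vector [vector [0, 1], vector [1, 0]]
     else if k = 2 then vector [vector [0, - \<i>], vector [\<i>, 0]]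
     else vector [vector [1, 0], vector [0, - 1]])"

definition pauli_comb :: "real^3 \<Rightarrow> complex^2^2" where
  "pauli_comb a = (\<Sum>k\<in>UNIV. (a $ k) *\<^sub>R pauli k)"

definition partial_deriv ::
  "'n::finite \<Rightarrow> (real^'n \<Rightarrow> 'b::real_normed_vector) \<Rightarrow> real^'n \<Rightarrow> 'b" where
  "partial_deriv i f \<theta> = vector_derivative (\<lambda>s. f (\<theta> + s *\<^sub>R axis i 1)) (at 0)"

definition M_mat :: "(real^'n \<Rightarrow> complex^2^2) \<Rightarrow> 'n::finite \<Rightarrow> real^'n \<Rightarrow> complex^2^2" where
  "M_mat U i \<theta> = smult_mat \<i> (conj_transpose (U \<theta>) ** partial_deriv i U \<theta>)"

(* Re only converts the type: the traces are real when U is a differentiable family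
   of unitary matrices. *)
definition m_vec :: "(real^'n \<Rightarrow> complex^2^2) \<Rightarrow> 'n::finite \<Rightarrow> real^'n \<Rightarrow> real^3" where
  "m_vec U i \<theta> = (\<chi> k. Re (1 / 2 * trace (pauli k ** M_mat U i \<theta>)))"

definition unitary_process :: "(real^'n \<Rightarrow> real^3) \<Rightarrow> real \<Rightarrow> real^'n \<Rightarrow> complex^2^2" where
  "unitary_process \<alpha> t \<theta> = mat_exp (smult_mat (- \<i> * complex_of_real t) (pauli_comb (\<alpha> \<theta>)))"

definition unit_dir :: "(real^'n \<Rightarrow> real^3) \<Rightarrow> real^'n \<Rightarrow> real^3" where
  "unit_dir \<alpha> \<theta> = \<alpha> \<theta> /\<^sub>R norm (\<alpha> \<theta>)"

end

theory Submission
  imports Defs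
begin

text \<open>Writing \<open>r = |\<alpha>|\<close> and \<open>n = \<alpha> / |\<alpha>|\<close>, the matrix \<open>N = -\<i> n \<cdot> \<sigma>\<close> satisfies \<open>N\<^sup>2 = -1\<close>,
  so the exponential series collapses to Euler's formula \<open>U = cos (r t) + sin (r t) N\<close>.
  The unit vector \<open>n\<close> is orthogonal to its derivative \<open>n'\<close>, hence \<open>N N' = -\<i> (n \<times> n') \<cdot> \<sigma>\<close>;
  this product is the source of the cross product term in \<open>\<i> U\<^sup>\<dagger> U'\<close>.\<close>

lemma mat_pow_0 [simp]: "mat_pow A 0 = mat 1"
  by (simp add: mat_pow_def)

lemma mat_pow_Suc [simp]: "mat_pow A (Suc k) = A ** mat_pow A k"
  by (simp add: mat_pow_def)

lemma matrix_mul_scaleR_left: "(c *\<^sub>R A) ** B = c *\<^sub>R ((A :: complex^'n^'m) ** B)"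
  by (simp add: matrix_matrix_mult_def vec_eq_iff scaleR_sum_right)

lemma matrix_mul_scaleR_right: "A ** (c *\<^sub>R B) = c *\<^sub>R ((A :: complex^'n^'m) ** B)"
  by (simp add: matrix_matrix_mult_def vec_eq_iff scaleR_sum_right)

lemma matrix_mul_add_rdistrib: "(A + B) ** C = (A :: complex^'n^'m) ** C + B ** C"
  by (simp add: matrix_matrix_mult_def vec_eq_iff sum.distrib algebra_simps)

text \<open>The powers of \<open>N\<close> run through 1, \<open>N\<close>, -1, \<open>-N\<close>
  with period four. \<open>cos_coeff\<close> and \<open>sin_coeff\<close> carry these signs, and
  \<open>fact k\<close> cancels their built-in denominators.\<close>

lemma mat_pow_scaleR_square_neg:
  fixes N :: "complex^'n^'n"
  assumes "N ** N = - mat 1"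
  shows "mat_pow (x *\<^sub>R N) k =
    (fact k * cos_coeff k * x ^ k) *\<^sub>R mat 1 + (fact k * sin_coeff k * x ^ k) *\<^sub>R N"
proof (induction k)
  case 0
  then show ?case by (simp add: cos_coeff_def sin_coeff_def)
next
  case (Suc k)
  \<comment> \<open>Multiplication by \<open>N\<close> moves the coefficient of 1 to
    \<open>N\<close>, and that of \<open>N\<close>, negated, to 1.\<close>
  have "fact (Suc k) * sin_coeff (Suc k) = fact k * (cos_coeff k :: real)"
    "fact (Suc k) * cos_coeff (Suc k) = - (fact k * (sin_coeff k :: real))"
    by (simp_all add: sin_coeff_Suc cos_coeff_Suc field_simps del: of_nat_Suc)
  then show ?case
    by (simp add: Suc matrix_add_ldistrib matrix_mul_scaleR_left matrix_mul_scaleR_right assms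
        scaleR_add_right ac_simps del: fact_Suc)
qed

lemma mat_exp_scaleR_square_neg:
  fixes N :: "complex^'n^'n"
  assumes "N ** N = - mat 1"
  shows "mat_exp (x *\<^sub>R N) = cos x *\<^sub>R mat 1 + sin x *\<^sub>R N"
proof -
  have "(\<lambda>k. (cos_coeff k *\<^sub>R x ^ k) *\<^sub>R mat 1 + (sin_coeff k *\<^sub>R x ^ k) *\<^sub>R N)
      sums (cos x *\<^sub>R mat 1 + sin x *\<^sub>R N)"
    by (intro sums_add sums_scaleR_left cos_converges sin_converges)
  moreover have "(1 / fact k) *\<^sub>R mat_pow (x *\<^sub>R N) k =
      (cos_coeff k *\<^sub>R x ^ k) *\<^sub>R mat 1 + (sin_coeff k *\<^sub>R x ^ k) *\<^sub>R N" for k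
    by (simp add: mat_pow_scaleR_square_neg[OF assms] scaleR_add_right)
  ultimately show ?thesis
    by (simp add: mat_exp_def sums_iff)
qed

lemma pauli_comb_nth:
  "pauli_comb a $ 1 $ 1 = of_real (a $ 3)"
  "pauli_comb a $ 1 $ 2 = of_real (a $ 1) - \<i> * of_real (a $ 2)"
  "pauli_comb a $ 2 $ 1 = of_real (a $ 1) + \<i> * of_real (a $ 2)"
  "pauli_comb a $ 2 $ 2 = - of_real (a $ 3)"
  by (simp_all add: pauli_comb_def pauli_def sum_3 complex_eq_iff)

text \<open>Pauli matrices are orthogonal for the trace form, so the trace reads off a
  coordinate.\<close>

lemma trace_pauli_comb: "trace (pauli k ** pauli_comb a) = 2 * of_real (a $ k)"
  using exhaust_3[of k]
  by (auto simp: trace_def matrix_matrix_mult_def sum_2 pauli_comb_nth pauli_def algebra_simps)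

text \<open>The factor \<open>- \<i>\<close> turns the Pauli matrices into quaternion units,
  identifying \<open>real^3\<close> with the imaginary quaternions; all later scalars are then
  real.\<close>

definition neg_i_pauli :: "real^3 \<Rightarrow> complex^2^2" where
  "neg_i_pauli a = smult_mat (- \<i>) (pauli_comb a)"

lemma bounded_linear_neg_i_pauli: "bounded_linear neg_i_pauli"
proof -
  have "linear neg_i_pauli"
    by (rule linearI)
      (simp_all add: neg_i_pauli_def smult_mat_def vec_eq_iff forall_2 pauli_comb_nth complex_eq_iff)
  then show ?thesis by (rule linear_conv_bounded_linear[THEN iffD1])
qed

text \<open>This is the product of two imaginary quaternions.\<close>

lemma neg_i_pauli_mult:
  "neg_i_pauli a ** neg_i_pauli b = neg_i_pauli (cross3 a b) - (a \<bullet> b) *\<^sub>R mat 1"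
  by (simp add: neg_i_pauli_def smult_mat_def vec_eq_iff forall_2 pauli_comb_nth complex_eq_iff
      matrix_matrix_mult_def sum_2 mat_def cross3_def inner_vec_def sum_3 algebra_simps)

lemma conj_transpose_neg_i_pauli:
  "conj_transpose (c *\<^sub>R mat 1 + s *\<^sub>R neg_i_pauli a) = c *\<^sub>R mat 1 + (- s) *\<^sub>R neg_i_pauli a"
  by (simp add: neg_i_pauli_def smult_mat_def conj_transpose_def vec_eq_iff forall_2
      pauli_comb_nth complex_eq_iff mat_def)

lemma smult_mat_i_neg_i_pauli: "smult_mat \<i> (neg_i_pauli a) = pauli_comb a"
  by (simp add: neg_i_pauli_def smult_mat_def vec_eq_iff)

lemma norm_unit_dir:
  assumes "\<alpha> \<theta> \<noteq> 0"
  shows "norm (unit_dir \<alpha> \<theta>) = 1"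
  using assms by (simp add: unit_dir_def)

lemma unitary_process_euler:
  assumes "\<alpha> \<theta> \<noteq> 0"
  shows "unitary_process \<alpha> t \<theta> =
    cos (norm (\<alpha> \<theta>) * t) *\<^sub>R mat 1 + sin (norm (\<alpha> \<theta>) * t) *\<^sub>R neg_i_pauli (unit_dir \<alpha> \<theta>)"
proof -
  interpret bounded_linear neg_i_pauli
    by (rule bounded_linear_neg_i_pauli)
  have "smult_mat (- \<i> * complex_of_real t) (pauli_comb (\<alpha> \<theta>)) = t *\<^sub>R neg_i_pauli (\<alpha> \<theta>)"
    by (simp add: neg_i_pauli_def smult_mat_def vec_eq_iff complex_eq_iff algebra_simps)
  also have "\<dots> = (norm (\<alpha> \<theta>) * t) *\<^sub>R neg_i_pauli (unit_dir \<alpha> \<theta>)"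
    using assms by (simp add: unit_dir_def scaleR)
  finally have "smult_mat (- \<i> * complex_of_real t) (pauli_comb (\<alpha> \<theta>)) =
      (norm (\<alpha> \<theta>) * t) *\<^sub>R neg_i_pauli (unit_dir \<alpha> \<theta>)" .
  moreover have "norm (unit_dir \<alpha> \<theta>) = 1"
    using assms by (rule norm_unit_dir)
  \<comment> \<open>A unit vector has zero cross product with itself, so its image squares to
    \<open>- mat 1\<close>.\<close>
  ultimately show ?thesis
    by (simp add: unitary_process_def mat_exp_scaleR_square_neg neg_i_pauli_mult norm_eq_1 zero)
qed

text \<open>The algebraic core: \<open>c\<close> and \<open>s\<close> stand for the cosine and sine
  of the phase, \<open>d\<close> for the derivative of the phase, and the second factor for the
  derivative of U.\<close>

lemma i_adjoint_mult_derivative: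
  fixes n n' :: "real^3" and c s d :: real
  assumes "c\<^sup>2 + s\<^sup>2 = 1" "n \<bullet> n = 1" "n \<bullet> n' = 0"
  shows "smult_mat \<i> (conj_transpose (c *\<^sub>R mat 1 + s *\<^sub>R neg_i_pauli n) **
      ((- s * d) *\<^sub>R mat 1 + ((c * d) *\<^sub>R neg_i_pauli n + s *\<^sub>R neg_i_pauli n'))) =
    pauli_comb (d *\<^sub>R n + (s * c) *\<^sub>R n' - s\<^sup>2 *\<^sub>R cross3 n n')"
proof -
  interpret bounded_linear neg_i_pauli
    by (rule bounded_linear_neg_i_pauli)
  \<comment> \<open>The multiples of \<open>mat 1\<close> cancel: \<open>- c * s * d\<close> meets
    \<open>+ s * c * d\<close> from the square of \<open>neg_i_pauli n\<close>, and
    \<open>n \<bullet> n' = 0\<close> removes the rest.\<close>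
  have "(c *\<^sub>R mat 1 + (- s) *\<^sub>R neg_i_pauli n) **
      ((- s * d) *\<^sub>R mat 1 + ((c * d) *\<^sub>R neg_i_pauli n + s *\<^sub>R neg_i_pauli n')) =
    ((c\<^sup>2 + s\<^sup>2) * d) *\<^sub>R neg_i_pauli n + (s * c) *\<^sub>R neg_i_pauli n'
      - s\<^sup>2 *\<^sub>R neg_i_pauli (cross3 n n')"
    unfolding matrix_add_ldistrib matrix_mul_add_rdistrib matrix_mul_scaleR_left
      matrix_mul_scaleR_right matrix_mul_lid matrix_mul_rid neg_i_pauli_mult assms(2,3)
    by (simp add: algebra_simps power2_eq_square)
  also have "\<dots> = neg_i_pauli (d *\<^sub>R n + (s * c) *\<^sub>R n' - s\<^sup>2 *\<^sub>R cross3 n n')"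
    by (simp add: assms(1) add diff scaleR)
  finally show ?thesis
    by (simp only: conj_transpose_neg_i_pauli smult_mat_i_neg_i_pauli)
qed

text \<open>The reality of the traces is included to show that \<open>Re\<close> in
  \<open>m_vec\<close> discards nothing.\<close>

theorem proposition2:
  fixes \<alpha> :: "real^'n \<Rightarrow> real^3" and S :: "(real^'n) set" and \<theta> :: "real^'n"
    and t :: real and i :: 'n
  assumes "open S"
    and "\<alpha> differentiable_on S"
    and "\<And>x. x \<in> S \<Longrightarrow> \<alpha> x \<noteq> 0"
    and "\<theta> \<in> S"
  shows "(\<forall>k. 1 / 2 * trace (pauli k ** M_mat (unitary_process \<alpha> t) i \<theta>) \<in> \<real>) \<and>
    m_vec (unitary_process \<alpha> t) i \<theta> =
      (partial_deriv i (\<lambda>x. norm (\<alpha> x)) \<theta> * t) *\<^sub>R unit_dir \<alpha> \<theta>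
      + (sin (norm (\<alpha> \<theta>) * t) * cos (norm (\<alpha> \<theta>) * t)) *\<^sub>R partial_deriv i (unit_dir \<alpha>) \<theta>
      - (sin (norm (\<alpha> \<theta>) * t))\<^sup>2 *\<^sub>R cross3 (unit_dir \<alpha> \<theta>) (partial_deriv i (unit_dir \<alpha>) \<theta>)"
proof -
  \<comment> \<open>Along this line the partial derivatives become ordinary derivatives at
    0.\<close>
  define L where "L = (\<lambda>s. \<theta> + s *\<^sub>R axis i (1::real))"
  define r where "r = (\<lambda>s. norm (\<alpha> (L s)))"
  define n where "n = (\<lambda>s. unit_dir \<alpha> (L s))"
  define r' where "r' = partial_deriv i (\<lambda>x. norm (\<alpha> x)) \<theta>"
  define n' where "n' = partial_deriv i (unit_dir \<alpha>) \<theta>"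
  have L0: "L 0 = \<theta>" by (simp add: L_def)
  have \<alpha>0: "\<alpha> \<theta> \<noteq> 0" using assms(3,4) .
  have "continuous_on UNIV L"
    unfolding L_def by (intro continuous_intros)
  \<comment> \<open>On this neighbourhood of 0 the vector \<alpha> does not vanish, so identities
    valid there can be differentiated at 0.\<close>
  then have near: "open (L -` S)" "0 \<in> L -` S"
    using assms(1,4) L0 by (simp_all add: open_vimage)
  have "\<alpha> differentiable (at (L 0))"
    using assms(1,2,4) by (simp add: L0 differentiable_on_eq_differentiable_at)
  moreover have "L differentiable (at 0)"
    unfolding L_def by (intro derivative_intros)
  ultimately have "(\<alpha> \<circ> L) differentiable (at 0)"
    by (intro differentiable_chain_at)
  then have d\<alpha>: "(\<lambda>s. \<alpha> (L s)) differentiable (at 0)"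
    by (simp add: o_def)
  have dr: "r differentiable (at 0)"
    using differentiable_chain_at[OF d\<alpha> differentiable_norm_at] \<alpha>0 L0
    by (simp add: r_def o_def)
  have "n = (\<lambda>s. inverse (r s) *\<^sub>R \<alpha> (L s))"
    by (simp add: n_def r_def unit_dir_def)
  then have dn: "n differentiable (at 0)"
    using dr d\<alpha> \<alpha>0 L0 by (simp add: r_def)
  have r': "(r has_field_derivative r') (at 0)"
    using dr by (simp add: r'_def partial_deriv_def r_def L_def vector_derivative_works
        has_real_derivative_iff_has_vector_derivative)
  have n': "(n has_vector_derivative n') (at 0)"
    using dn by (simp add: n'_def partial_deriv_def n_def L_def vector_derivative_works)
  have unit: "n s \<bullet> n s = 1" if "L s \<in> S" for s
    using assms(3)[OF that] by (simp add: n_def norm_unit_dir flip: norm_eq_1)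
  \<comment> \<open>Orthogonality comes from differentiating \<open>n s \<bullet> n s\<close>, which
    equals 1 near 0, in two ways.\<close>
  have "((\<lambda>s. n s \<bullet> n s) has_vector_derivative (n 0 \<bullet> n' + n' \<bullet> n 0)) (at 0)"
    by (rule bounded_bilinear.has_vector_derivative[OF bounded_bilinear_inner n' n'])
  then have "((\<lambda>s. 1 :: real) has_vector_derivative (n 0 \<bullet> n' + n' \<bullet> n 0)) (at 0)"
    by (rule has_vector_derivative_transform_within_open[OF _ near]) (simp add: unit)
  then have orth: "n 0 \<bullet> n' = 0"
    using vector_derivative_unique_at[OF _ has_vector_derivative_const[of "1::real"]]
    by (fastforce simp: inner_commute)
  define c s where "c = cos (r 0 * t)" and "s = sin (r 0 * t)"
  have "((\<lambda>x. cos (r x * t) *\<^sub>R (mat 1 :: complex^2^2) + sin (r x * t) *\<^sub>R neg_i_pauli (n x))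
      has_vector_derivative
        (- s * (r' * t)) *\<^sub>R mat 1 + ((c * (r' * t)) *\<^sub>R neg_i_pauli (n 0) + s *\<^sub>R neg_i_pauli n'))
      (at 0)"
    unfolding c_def s_def
    by (auto intro!: derivative_eq_intros r' n'
        bounded_linear.has_vector_derivative[OF bounded_linear_neg_i_pauli])
  \<comment> \<open>Euler's formula holds throughout the neighbourhood, so its derivative is that of
    U.\<close>
  then have "((\<lambda>x. unitary_process \<alpha> t (L x)) has_vector_derivative
        (- s * (r' * t)) *\<^sub>R mat 1 + ((c * (r' * t)) *\<^sub>R neg_i_pauli (n 0) + s *\<^sub>R neg_i_pauli n'))
      (at 0)"
    by (rule has_vector_derivative_transform_within_open[OF _ near])
      (simp add: unitary_process_euler assms(3) r_def n_def)
  then have "partial_deriv i (unitary_process \<alpha> t) \<theta> =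
      (- s * (r' * t)) *\<^sub>R mat 1 + ((c * (r' * t)) *\<^sub>R neg_i_pauli (n 0) + s *\<^sub>R neg_i_pauli n')"
    by (simp add: partial_deriv_def L_def vector_derivative_at)
  moreover have "unitary_process \<alpha> t \<theta> = c *\<^sub>R mat 1 + s *\<^sub>R neg_i_pauli (n 0)"
    using \<alpha>0 by (simp add: unitary_process_euler c_def s_def r_def n_def L0)
  moreover have "n 0 \<bullet> n 0 = 1"
    using unit L0 assms(4) by simp
  ultimately have M: "M_mat (unitary_process \<alpha> t) i \<theta> =
      pauli_comb ((r' * t) *\<^sub>R n 0 + (s * c) *\<^sub>R n' - s\<^sup>2 *\<^sub>R cross3 (n 0) n')"
    using i_adjoint_mult_derivative[of c s "n 0" n' "r' * t"] orth
    by (simp add: M_mat_def c_def s_def)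
  \<comment> \<open>\<open>M\<close> is now the Pauli combination of a real vector, so the trace
    formula gives both reality and the coordinates.\<close>
  show ?thesis
    unfolding m_vec_def M trace_pauli_comb
    by (simp add: vec_eq_iff r'_def n'_def n_def c_def s_def r_def L0)
qed

end
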